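(* Let $n\ge 2$ and let $\bm X=(X_1,\dots,X_n)$ be a random vector whose components take values in finite alphabets. Then $$\Omega(\bm X)=\mathrm{RSI}(\bm X^{n-1};X_n)+\sum_{j=2}^{n-2}\mathrm{RSI}(\bm X^{j};X_{j+1}\mid \bm X_{j+2}^n),$$ where an empty sum is zero.
   Context: $H$ denotes Shannon entropy and $I$ Shannon mutual information. Notation: $\bm X_i^j=(X_i,\dots,X_j)$ for $1\le i\le j\le n$, $\bm X^j=\bm X_1^j$, and $\bm X_{-j}$ is $\bm X$ with $X_j$ deleted. The O-information is $$\Omega(\bm X)=(n-2)H(\bm X)+\sum_{j=1}^n\big(H(X_j)-H(\bm X_{-j})\big).$$ For a random vector $\bm U=(U_1,\dots,U_k)$ and a random variable $V$, the redundancy-synergy index is $$\mathrm{RSI}(\bm U;V)=\sum_{i=1}^k I(U_i;V)-I(\bm U;V),$$ and its conditional version given $\bm W$ is the average over $\bm w\sim\bm W$ of the RSI computed under the conditional law given $\bm W=\bm w$, i.e. $\mathrm{RSI}(\bm U;V\mid\bm W)=\sum_{i=1}^k I(U_i;V\mid\bm W)-I(\bm U;V\mid\bm W)$. *)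

theory Defs
  imports "HOL-Probability.Information"
begin

definition subvector :: "(nat \<Rightarrow> 'a \<Rightarrow> 'b) \<Rightarrow> nat set \<Rightarrow> 'a \<Rightarrow> nat \<Rightarrow> 'b" where
  "subvector X J = (\<lambda>\<omega>. \<lambda>i\<in>J. X i \<omega>)"

context information_space
begin

text \<open>Components of a random vector of length \<open>n\<close> are indexed from \<open>1\<close> to \<open>n\<close>.\<close>

definition O_information :: "nat \<Rightarrow> (nat \<Rightarrow> 'a \<Rightarrow> 'b) \<Rightarrow> real" where
  "O_information n X =
     (real n - 2) * \<H>(subvector X {1..n})
     + (\<Sum>j = 1..n. \<H>(X j) - \<H>(subvector X ({1..n} - {j})))"

definition RSI :: "nat \<Rightarrow> (nat \<Rightarrow> 'a \<Rightarrow> 'b) \<Rightarrow> ('a \<Rightarrow> 'c) \<Rightarrow> real" where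
  "RSI k U V = (\<Sum>i = 1..k. \<I>(U i ; V)) - \<I>(subvector U {1..k} ; V)"

end

text \<open>
  The conditional law given \<open>W = w\<close> is the measure \<open>uniform_measure M {\<omega> \<in> space M. W \<omega> = w}\<close>,
  which sends an event \<open>A\<close> to \<open>P (A \<inter> {W = w}) / P (W = w)\<close>. It is a probability measure
  only for values \<open>w\<close> of positive probability; the other values have weight \<open>0\<close> in the average.
  The definition is meant for \<open>W\<close> with finite range.
\<close>

definition (in information_space) conditional_RSI ::
    "nat \<Rightarrow> (nat \<Rightarrow> 'a \<Rightarrow> 'b) \<Rightarrow> ('a \<Rightarrow> 'c) \<Rightarrow> ('a \<Rightarrow> 'd) \<Rightarrow> real" where
  "conditional_RSI k U V W =
     (\<Sum>w \<in> W ` space M. measure M {\<omega> \<in> space M. W \<omega> = w} *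
        information_space.RSI (uniform_measure M {\<omega> \<in> space M. W \<omega> = w}) b k U V)"

end

theory Submission
  imports Defs
begin

text \<open>
  Write \<open>h J\<close> for the entropy of the subvector with index set \<open>J\<close>. Averaging entropies over the
  conditional laws given \<open>W\<close> gives the entropies conditional on \<open>W\<close>, so the chain rule turns every
  term of the decomposition into a combination of values of \<open>h\<close>. The unconditional term is the case
  \<open>j = n - 1\<close> of the conditional ones (empty conditioning), and the case \<open>j = 1\<close> vanishes. Hence the
  right-hand side is a sum over all \<open>j\<close> from \<open>1\<close> to \<open>n - 1\<close>, which telescopes for an arbitrary
  set function \<open>h\<close> with \<open>h {} = 0\<close>.
\<close>

section \<open>Simple functions and finite subvectors\<close>

lemma simple_function_uniform_measure:
  "simple_function (uniform_measure M A) f \<longleftrightarrow> simple_function M f"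
  by (simp add: simple_function_def)

lemma subvector_eq_iff:
  "subvector X J \<omega> = subvector X J \<omega>' \<longleftrightarrow> (\<forall>i\<in>J. X i \<omega> = X i \<omega>')"
  by (auto simp: subvector_def fun_eq_iff restrict_def)

text \<open>The values lie in a finite product of finite ranges, and each fibre is a finite
  intersection of fibres of the components.\<close>

lemma simple_function_subvector:
  assumes "finite J" and X: "\<And>i. i \<in> J \<Longrightarrow> simple_function M (X i)"
  shows "simple_function M (subvector X J)"
  unfolding simple_function_def
proof (intro conjI ballI)
  have "subvector X J ` space M \<subseteq> (\<Pi>\<^sub>E i\<in>J. X i ` space M)"
    by (auto simp: subvector_def)
  then show "finite (subvector X J ` space M)"
    by (rule finite_subset) (use assms in \<open>auto intro!: finite_PiE dest: simple_functionD\<close>)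
next
  fix y assume "y \<in> subvector X J ` space M"
  then obtain \<omega>' where "y = subvector X J \<omega>'" by auto
  then have "subvector X J -` {y} \<inter> space M = {\<omega> \<in> space M. \<forall>i\<in>J. X i \<omega> = X i \<omega>'}"
    by (auto simp: subvector_eq_iff)
  also have "\<dots> \<in> sets M"
  proof (rule sets.sets_Collect_finite_All)
    fix i assume "i \<in> J"
    then show "{\<omega> \<in> space M. X i \<omega> = X i \<omega>'} \<in> sets M"
      using simple_functionD(2)[OF X, of i "{X i \<omega>'}"] by (simp add: vimage_def Int_def conj_commute)
  qed fact
  finally show "subvector X J -` {y} \<inter> space M \<in> sets M" .
qed

section \<open>Entropy of simple functions\<close>

context information_space
begin

lemma entropy_simple:
  assumes "simple_function M Y"
  shows "\<H>(Y) = - (\<Sum>y\<in>Y ` space M. prob (Y -` {y} \<inter> space M) * log b (prob (Y -` {y} \<inter> space M)))"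
  by (rule entropy_simple_distributed[OF simple_distributedI[OF assms measure_nonneg refl]])

text \<open>Entropy depends only on the partition of the space into fibres, not on the labels. This
  is what identifies pairs such as \<open>(V \<omega>, U \<omega>)\<close> with subvectors, although
  their types differ.\<close>

lemma entropy_eq_if_same_fibres:
  assumes Y: "simple_function M Y" and Z: "simple_function M Z"
    and eq: "\<And>\<omega> \<omega>'. \<omega> \<in> space M \<Longrightarrow> \<omega>' \<in> space M \<Longrightarrow> Y \<omega> = Y \<omega>' \<longleftrightarrow> Z \<omega> = Z \<omega>'"
  shows "\<H>(Y) = \<H>(Z)"
proof -
  \<comment> \<open>Relabelling of the values of \<open>Y\<close> as values of \<open>Z\<close>,
    through a chosen point of each fibre; equality of the fibres makes the choice irrelevant and
    \<open>f\<close> injective.\<close>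
  define f where "f y = Z (inv_into (space M) Y y)" for y
  have f: "f (Y \<omega>) = Z \<omega>" if "\<omega> \<in> space M" for \<omega>
    unfolding f_def using that by (subst eq[symmetric]) (auto intro: inv_into_into f_inv_into_f)
  have img: "Z ` space M = f ` Y ` space M"
    by (auto simp: f image_image)
  have inj: "inj_on f (Y ` space M)"
    by (auto simp: inj_on_def f eq)
  have "Z -` {f (Y \<omega>)} \<inter> space M = Y -` {Y \<omega>} \<inter> space M" if "\<omega> \<in> space M" for \<omega>
    using that by (auto simp: f eq)
  then show ?thesis
    unfolding entropy_simple[OF Y] entropy_simple[OF Z]
    unfolding img
    by (subst sum.reindex[OF inj]) (auto intro!: sum.cong)
qed

lemma entropy_const: "\<H>(\<lambda>_. c) = 0"
proof -
  have "space M \<noteq> {}" by (rule not_empty)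
  then have "(\<lambda>_. c) ` space M = {c}" by auto
  then show ?thesis
    by (subst entropy_simple) (auto simp: prob_space)
qed

lemma mutual_information_eq_entropies:
  assumes "simple_function M U" "simple_function M V"
  shows "\<I>(U ; V) = \<H>(U) + \<H>(V) - \<H>(\<lambda>\<omega>. (V \<omega>, U \<omega>))"
  using mutual_information_eq_entropy_conditional_entropy[OF assms]
    entropy_chain_rule[OF assms(2,1)] by simp

lemma RSI_eq_entropies:
  assumes "\<And>i. i \<in> {1..k} \<Longrightarrow> simple_function M (U i)" "simple_function M V"
  shows "RSI k U V = (\<Sum>i = 1..k. \<H>(U i) + \<H>(V) - \<H>(\<lambda>\<omega>. (V \<omega>, U i \<omega>)))
    - (\<H>(subvector U {1..k}) + \<H>(V) - \<H>(\<lambda>\<omega>. (V \<omega>, subvector U {1..k} \<omega>)))"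
proof -
  have "simple_function M (subvector U {1..k})"
    using assms(1) by (intro simple_function_subvector) auto
  then show ?thesis
    unfolding RSI_def using assms by (simp add: mutual_information_eq_entropies)
qed

section \<open>Conditional laws and averages over them\<close>

lemma information_space_uniform_measure:
  assumes "prob A > 0"
  shows "information_space (uniform_measure M A) b"
proof -
  have "prob_space (uniform_measure M A)"
    using assms by (intro prob_space_uniform_measure) (auto simp: emeasure_eq_measure)
  then show ?thesis
    using b_gt_1 by (simp add: information_space_def information_space_axioms_def)
qed

text \<open>Weighting the entropy of the conditional law by the probability of \<open>w\<close>
  turns each p(y,w)/p(w) in front of the logarithm into p(y,w), which is the summand of the
  conditional entropy.\<close>

lemma average_entropy_eq_conditional_entropy:
  assumes Y: "simple_function M Y" and W: "simple_function M W"
  shows "(\<Sum>w \<in> W ` space M. prob {\<omega> \<in> space M. W \<omega> = w} *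
      prob_space.entropy (uniform_measure M {\<omega> \<in> space M. W \<omega> = w}) b (count_space (Y ` space M)) Y)
    = \<H>(Y | W)"
proof -
  define pW where "pW w = prob {\<omega> \<in> space M. W \<omega> = w}" for w
  define pYW where "pYW y w = prob {\<omega> \<in> space M. Y \<omega> = y \<and> W \<omega> = w}" for y w
  have W_sets: "{\<omega> \<in> space M. W \<omega> = w} \<in> sets M" for w
    using simple_functionD(2)[OF W, of "{w}"] by (simp add: vimage_def Int_def conj_commute)
  have Y_sets: "Y -` {y} \<inter> space M \<in> sets M" for y
    by (rule simple_functionD(2)[OF Y])
  have pYW_le: "pYW y w \<le> pW w" for y w
    unfolding pYW_def pW_def by (rule finite_measure_mono) (auto intro: W_sets)
  have slice: "pW w * prob_space.entropy (uniform_measure M {\<omega> \<in> space M. W \<omega> = w}) b (count_space (Y ` space M)) Y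
      = - (\<Sum>y \<in> Y ` space M. pYW y w * log b (pYW y w / pW w))" for w
  \<comment> \<open>For a null value \<open>w\<close> the entropy on the left is meaningless, but
    its weight is 0, and on the right \<open>pYW y w\<close> is 0 by \<open>pYW_le\<close>.\<close>
  proof (cases "pW w = 0")
    case True
    then have "pYW y w = 0" for y
      using pYW_le[of y w] measure_nonneg[of M] by (simp add: pYW_def order_antisym)
    with True show ?thesis by simp
  next
    case False
    then have pos: "pW w > 0"
      by (simp add: pW_def zero_less_measure_iff)
    let ?N = "uniform_measure M {\<omega> \<in> space M. W \<omega> = w}"
    interpret N: information_space ?N b
      using pos unfolding pW_def by (rule information_space_uniform_measure)
    have "measure ?N (Y -` {y} \<inter> space M) = pYW y w / pW w" for y
    proof -
      have "measure ?N (Y -` {y} \<inter> space M) =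
          prob ({\<omega> \<in> space M. W \<omega> = w} \<inter> (Y -` {y} \<inter> space M)) / pW w"
        using pos Y_sets unfolding pW_def
        by (subst measure_uniform_measure) (auto simp: emeasure_eq_measure)
      also have "{\<omega> \<in> space M. W \<omega> = w} \<inter> (Y -` {y} \<inter> space M) = {\<omega> \<in> space M. Y \<omega> = y \<and> W \<omega> = w}"
        by auto
      finally show ?thesis by (simp add: pYW_def)
    qed
    then have "N.entropy b (count_space (Y ` space M)) Y =
        - (\<Sum>y \<in> Y ` space M. pYW y w / pW w * log b (pYW y w / pW w))"
      using N.entropy_simple[of Y] Y by (simp add: simple_function_uniform_measure)
    then show ?thesis
      using pos by (simp add: sum_distrib_left)
  qed
  have fin: "finite (Y ` space M)" "finite (W ` space M)"
    using Y W by (auto dest: simple_functionD)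
  have "\<H>(Y | W) = - (\<Sum>(y, w) \<in> (\<lambda>\<omega>. (Y \<omega>, W \<omega>)) ` space M. pYW y w * log b (pYW y w / pW w))"
  proof -
    have "simple_distributed M W pW"
      using W by (rule simple_distributedI)
        (auto simp: pW_def measure_nonneg intro!: arg_cong[where f=prob])
    moreover have "simple_distributed M (\<lambda>\<omega>. (Y \<omega>, W \<omega>)) (\<lambda>(y, w). pYW y w)"
      using simple_function_Pair[OF Y W] by (rule simple_distributedI)
        (auto simp: pYW_def measure_nonneg intro!: arg_cong[where f=prob])
    ultimately show ?thesis
      by (subst conditional_entropy_eq[where Py = pW and Pxy = "\<lambda>(y, w). pYW y w"]) auto
  qed
  \<comment> \<open>Pairs that never occur jointly have probability 0, so the sum may run over the
    full product and be reordered with \<open>w\<close> outermost.\<close>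
  also have "(\<Sum>(y, w) \<in> (\<lambda>\<omega>. (Y \<omega>, W \<omega>)) ` space M. pYW y w * log b (pYW y w / pW w)) =
      (\<Sum>(y, w) \<in> Y ` space M \<times> W ` space M. pYW y w * log b (pYW y w / pW w))"
  proof (rule sum.mono_neutral_left)
    have "pYW y w = 0" if "(y, w) \<notin> (\<lambda>\<omega>. (Y \<omega>, W \<omega>)) ` space M" for y w
    proof -
      have "{\<omega> \<in> space M. Y \<omega> = y \<and> W \<omega> = w} = {}"
        using that by auto
      then show ?thesis unfolding pYW_def by (simp only: measure_empty)
    qed
    then show "\<forall>x \<in> Y ` space M \<times> W ` space M - (\<lambda>\<omega>. (Y \<omega>, W \<omega>)) ` space M.
        (case x of (y, w) \<Rightarrow> pYW y w * log b (pYW y w / pW w)) = 0"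
      by auto
  qed (use fin in auto)
  also have "\<dots> = (\<Sum>w \<in> W ` space M. \<Sum>y \<in> Y ` space M. pYW y w * log b (pYW y w / pW w))"
    by (subst sum.cartesian_product[symmetric]) (rule sum.swap)
  finally show ?thesis
    using slice by (simp add: pW_def sum_negf)
qed

lemma conditional_RSI_eq_conditional_entropies:
  assumes U: "\<And>i. i \<in> {1..k} \<Longrightarrow> simple_function M (U i)"
    and V: "simple_function M V" and W: "simple_function M W"
  shows "conditional_RSI k U V W =
    (\<Sum>i = 1..k. \<H>(U i | W) + \<H>(V | W) - \<H>(\<lambda>\<omega>. (V \<omega>, U i \<omega>) | W))
    - (\<H>(subvector U {1..k} | W) + \<H>(V | W) - \<H>(\<lambda>\<omega>. (V \<omega>, subvector U {1..k} \<omega>) | W))"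
proof -
  define p where "p w = prob {\<omega> \<in> space M. W \<omega> = w}" for w
  define N where "N w = uniform_measure M {\<omega> \<in> space M. W \<omega> = w}" for w
  define HU where "HU w i = prob_space.entropy (N w) b (count_space (U i ` space M)) (U i)" for w i
  define HV where "HV w = prob_space.entropy (N w) b (count_space (V ` space M)) V" for w
  define HVU where "HVU w i = prob_space.entropy (N w) b
      (count_space ((\<lambda>\<omega>. (V \<omega>, U i \<omega>)) ` space M)) (\<lambda>\<omega>. (V \<omega>, U i \<omega>))" for w i
  let ?S = "subvector U {1..k}"
  define HS where "HS w = prob_space.entropy (N w) b (count_space (?S ` space M)) ?S" for w
  define HVS where "HVS w = prob_space.entropy (N w) b
      (count_space ((\<lambda>\<omega>. (V \<omega>, ?S \<omega>)) ` space M)) (\<lambda>\<omega>. (V \<omega>, ?S \<omega>))" for w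
  have S: "simple_function M ?S"
    using U by (intro simple_function_subvector) auto
  note avg = average_entropy_eq_conditional_entropy[OF _ W, folded N_def p_def]
  \<comment> \<open>The weight \<open>p w\<close> is distributed over every entropy so that each one
    can be averaged separately by \<open>avg\<close>. It also makes both sides 0 at null
    values.\<close>
  have "p w * information_space.RSI (N w) b k U V =
      (\<Sum>i = 1..k. p w * HU w i + p w * HV w - p w * HVU w i)
      - (p w * HS w + p w * HV w - p w * HVS w)" for w
  proof (cases "p w = 0")
    case False
    then have "p w > 0" by (simp add: p_def zero_less_measure_iff)
    then interpret N: information_space "N w" b
      unfolding p_def N_def by (rule information_space_uniform_measure)
    have "N.RSI k U V = (\<Sum>i = 1..k. HU w i + HV w - HVU w i) - (HS w + HV w - HVS w)"
      using U V by (subst N.RSI_eq_entropies)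
        (simp_all add: N_def simple_function_uniform_measure HU_def HV_def HVU_def HS_def HVS_def)
    then show ?thesis
      by (simp only:) (simp add: algebra_simps sum_distrib_left)
  qed simp
  then have "conditional_RSI k U V W = (\<Sum>w \<in> W ` space M.
      (\<Sum>i = 1..k. p w * HU w i + p w * HV w - p w * HVU w i)
      - (p w * HS w + p w * HV w - p w * HVS w))"
    by (simp add: conditional_RSI_def p_def N_def)
  also have "\<dots> = (\<Sum>i = 1..k. (\<Sum>w \<in> W ` space M. p w * HU w i) + (\<Sum>w \<in> W ` space M. p w * HV w)
        - (\<Sum>w \<in> W ` space M. p w * HVU w i))
      - ((\<Sum>w \<in> W ` space M. p w * HS w) + (\<Sum>w \<in> W ` space M. p w * HV w)
        - (\<Sum>w \<in> W ` space M. p w * HVS w))"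
    by (simp add: sum_subtractf sum.distrib sum.swap[of _ "W ` space M"] sum_distrib_left)
  also have "\<dots> = (\<Sum>i = 1..k. \<H>(U i | W) + \<H>(V | W) - \<H>(\<lambda>\<omega>. (V \<omega>, U i \<omega>) | W))
    - (\<H>(?S | W) + \<H>(V | W) - \<H>(\<lambda>\<omega>. (V \<omega>, ?S \<omega>) | W))"
    unfolding HU_def HV_def HVU_def HS_def HVS_def
    using U V S by (simp add: avg simple_function_Pair)
  finally show ?thesis .
qed

end

section \<open>The telescoping identity for set functions\<close>

text \<open>
  With \<open>h J\<close> the entropy of the subvector indexed by \<open>J\<close>, this is the redundancy-synergy index of
  the components \<open>1..j\<close> about the component \<open>j + 1\<close>, given those indexed by \<open>j + 2..n\<close>.
\<close>

definition rsi_term :: "(nat set \<Rightarrow> real) \<Rightarrow> nat \<Rightarrow> nat \<Rightarrow> real" where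
  "rsi_term h n j =
     (\<Sum>i = 1..j. h (insert i {j+2..n}) + h {j+1..n} - h {j+2..n} - h (insert i {j+1..n}))
     - (h ({1..n} - {j+1}) + h {j+1..n} - h {j+2..n} - h {1..n})"

text \<open>Induction on \<open>m\<close>: the negative terms \<open>h (insert i {m+2..n})\<close>
  of the next summand cancel the leading sum, which is rebuilt with a shorter tail. For
  \<open>m = n - 1\<close> the tail \<open>{m+2..n}\<close> is empty and only singletons remain
  there.\<close>

lemma sum_rsi_term_partial:
  assumes "m < n"
  shows "(\<Sum>j = 1..m. rsi_term h n j) =
    (\<Sum>i = 1..m. h (insert i {m+2..n})) + h {m+1..n} - h {1..n} - h {2..n}
    - (real m - 1) * h {m+2..n} - (\<Sum>k = 2..m+1. h ({1..n} - {k})) + real m * h {1..n}"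
  using assms
proof (induction m)
  case (Suc m)
  \<comment> \<open>The new index \<open>i = Suc m\<close> has no partner in the leading sum; its
    negative term cancels the separate \<open>h {m+1..n}\<close> instead.\<close>
  have "insert (Suc m) {m+2..n} = {m+1..n}"
    using Suc.prems by auto
  then show ?case
    using Suc by (simp add: rsi_term_def sum.distrib sum_subtractf algebra_simps)
qed (simp add: numeral_2_eq_2)

lemma sum_rsi_term:
  assumes "n \<ge> 2" and "h {} = 0"
  shows "(\<Sum>j = 1..n-1. rsi_term h n j) =
    (real n - 2) * h {1..n} + (\<Sum>j = 1..n. h {j} - h ({1..n} - {j}))"
proof -
  obtain m where n: "n = Suc m" using assms by (cases n) auto
  \<comment> \<open>The partial sums carry \<open>h {2..n}\<close> apart from the deletions of
    \<open>k \<ge> 2\<close>; it is the deletion of the first index.\<close>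
  have "{1..n} - {1} = {2..n}" by auto
  then have "(\<Sum>j = 1..n. h ({1..n} - {j})) = h {2..n} + (\<Sum>k = 2..n. h ({1..n} - {k}))"
    using assms by (subst sum.atLeast_Suc_atMost) (auto simp: numeral_2_eq_2)
  then show ?thesis
    using sum_rsi_term_partial[of m n h] assms(2) by (simp add: n sum_subtractf algebra_simps)
qed

text \<open>With a single source, the sum of individual informations and the joint information
  coincide. Hence the sum in the theorem can start at 2.\<close>

lemma rsi_term_1:
  assumes "n \<ge> 2"
  shows "rsi_term h n 1 = 0"
proof -
  have "{1..n} - {2} = insert 1 {3..n}" "insert 1 {2..n} = {1..n}"
    using assms by auto
  then show ?thesis by (simp add: rsi_term_def numeral_3_eq_3 numeral_2_eq_2)
qed

section \<open>Redundancy-synergy indices as values of the set function\<close>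

context information_space
begin

text \<open>By the chain rule every entropy given \<open>?W\<close> is a joint entropy with
  \<open>?W\<close> minus \<open>?h {j+2..n}\<close>. Comparing fibres turns each joint entropy into
  the entropy of one subvector.\<close>

lemma conditional_RSI_eq_rsi_term:
  assumes X: "\<And>i. i \<in> {1..n} \<Longrightarrow> simple_function M (X i)" and "j < n"
  shows "conditional_RSI j X (X (j + 1)) (subvector X {j + 2..n}) =
    rsi_term (\<lambda>J. \<H>(subvector X J)) n j"
proof -
  let ?W = "subvector X {j + 2..n}" and ?S = "subvector X {1..j}" and ?h = "\<lambda>J. \<H>(subvector X J)"
  have sub: "simple_function M (subvector X J)" if "J \<subseteq> {1..n}" for J
    using that X by (intro simple_function_subvector) (auto intro: finite_subset)
  have W: "simple_function M ?W" and S: "simple_function M ?S" and V: "simple_function M (X (j + 1))"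
    and U: "\<And>i. i \<in> {1..j} \<Longrightarrow> simple_function M (X i)"
    using assms by (auto intro: sub X)
  have "\<H>(X i | ?W) = ?h (insert i {j+2..n}) - ?h {j+2..n}" if "i \<in> {1..j}" for i
  proof -
    have "\<H>(\<lambda>\<omega>. (?W \<omega>, X i \<omega>)) = ?h (insert i {j+2..n})"
      using that \<open>j < n\<close> by (intro entropy_eq_if_same_fibres simple_function_Pair W U sub)
        (auto simp: subvector_eq_iff)
    then show ?thesis
      using entropy_chain_rule[OF W U[OF that]] by simp
  qed
  moreover have "\<H>(X (j+1) | ?W) = ?h {j+1..n} - ?h {j+2..n}"
  proof -
    have "{j+1..n} = insert (j+1) {j+2..n}" using \<open>j < n\<close> by auto
    then have "\<H>(\<lambda>\<omega>. (?W \<omega>, X (j+1) \<omega>)) = ?h {j+1..n}"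
      using \<open>j < n\<close> by (intro entropy_eq_if_same_fibres simple_function_Pair W V sub)
        (auto simp: subvector_eq_iff)
    then show ?thesis
      using entropy_chain_rule[OF W V] by simp
  qed
  moreover have "\<H>(\<lambda>\<omega>. (X (j+1) \<omega>, X i \<omega>) | ?W) = ?h (insert i {j+1..n}) - ?h {j+2..n}"
    if "i \<in> {1..j}" for i
  proof -
    have "{j+1..n} = insert (j+1) {j+2..n}" using \<open>j < n\<close> by auto
    then have "\<H>(\<lambda>\<omega>. (?W \<omega>, X (j+1) \<omega>, X i \<omega>)) = ?h (insert i {j+1..n})"
      using that \<open>j < n\<close> by (intro entropy_eq_if_same_fibres simple_function_Pair W V U sub)
        (auto simp: subvector_eq_iff)
    then show ?thesis
      using entropy_chain_rule[OF W simple_function_Pair[OF V U[OF that]]] by simp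
  qed
  moreover have "\<H>(?S | ?W) = ?h ({1..n} - {j+1}) - ?h {j+2..n}"
  proof -
    \<comment> \<open>Sources and conditioning variables together are all components except the
      target \<open>j+1\<close>.\<close>
    have "{1..n} - {j+1} = {1..j} \<union> {j+2..n}" using \<open>j < n\<close> by auto
    then have "\<H>(\<lambda>\<omega>. (?W \<omega>, ?S \<omega>)) = ?h ({1..n} - {j+1})"
      using \<open>j < n\<close> by (intro entropy_eq_if_same_fibres simple_function_Pair W S sub)
        (auto simp: subvector_eq_iff)
    then show ?thesis
      using entropy_chain_rule[OF W S] by simp
  qed
  moreover have "\<H>(\<lambda>\<omega>. (X (j+1) \<omega>, ?S \<omega>) | ?W) = ?h {1..n} - ?h {j+2..n}"
  proof -
    have "{1..n} = {1..j} \<union> insert (j+1) {j+2..n}" using \<open>j < n\<close> by auto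
    then have "\<H>(\<lambda>\<omega>. (?W \<omega>, X (j+1) \<omega>, ?S \<omega>)) = ?h {1..n}"
      using \<open>j < n\<close> by (intro entropy_eq_if_same_fibres simple_function_Pair W V S sub)
        (auto simp: subvector_eq_iff)
    then show ?thesis
      using entropy_chain_rule[OF W simple_function_Pair[OF V S]] by simp
  qed
  ultimately show ?thesis
    unfolding rsi_term_def by (subst conditional_RSI_eq_conditional_entropies[OF U V W])
      (auto intro!: sum.cong)
qed

lemma entropy_subvector_empty: "\<H>(subvector X {}) = 0"
  \<comment> \<open>Restriction to the empty index set gives the function that is
    \<open>undefined\<close> everywhere, hence a constant variable.\<close>
  using entropy_const[of "\<lambda>_. undefined"] by (simp add: subvector_def restrict_def)

lemma entropy_subvector_singleton:
  assumes "simple_function M (X i)"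
  shows "\<H>(subvector X {i}) = \<H>(X i)"
  using assms by (intro entropy_eq_if_same_fibres simple_function_subvector) (auto simp: subvector_eq_iff)

text \<open>For \<open>j = n - 1\<close> the conditioning set \<open>{j+2..n}\<close> is empty and
  its entropy is 0, so \<open>rsi_term\<close> reduces to unconditional entropies.\<close>

lemma RSI_eq_rsi_term:
  assumes X: "\<And>i. i \<in> {1..n} \<Longrightarrow> simple_function M (X i)" and "n \<ge> 1"
  shows "RSI (n - 1) X (X n) = rsi_term (\<lambda>J. \<H>(subvector X J)) n (n - 1)"
proof -
  let ?S = "subvector X {1..n-1}" and ?h = "\<lambda>J. \<H>(subvector X J)"
  have sub: "simple_function M (subvector X J)" if "J \<subseteq> {1..n}" for J
    using that X by (intro simple_function_subvector) (auto intro: finite_subset)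
  have S: "simple_function M ?S" and V: "simple_function M (X n)"
    and U: "\<And>i. i \<in> {1..n-1} \<Longrightarrow> simple_function M (X i)"
    using assms(2) by (auto intro!: sub X)
  have "\<H>(\<lambda>\<omega>. (X n \<omega>, X i \<omega>)) = ?h {i, n}" if "i \<in> {1..n-1}" for i
    using that \<open>n \<ge> 1\<close> by (intro entropy_eq_if_same_fibres simple_function_Pair V U sub)
      (auto simp: subvector_eq_iff)
  moreover have "\<H>(\<lambda>\<omega>. (X n \<omega>, ?S \<omega>)) = ?h {1..n}"
  proof -
    have "{1..n} = insert n {1..n-1}" using \<open>n \<ge> 1\<close> by auto
    then show ?thesis
      by (intro entropy_eq_if_same_fibres simple_function_Pair V S sub)
        (auto simp: subvector_eq_iff)
  qed
  moreover have "{1..n} - {n} = {1..n-1}" by auto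
  moreover have "?h {i} = \<H>(X i)" if "i \<in> {1..n}" for i
    using X[OF that] by (rule entropy_subvector_singleton)
  ultimately show ?thesis
    unfolding rsi_term_def using \<open>n \<ge> 1\<close>
    by (subst RSI_eq_entropies[OF U V]) (auto simp: entropy_subvector_empty intro!: sum.cong)
qed

end

theorem corollary2:
  fixes M :: "'a measure" and b :: real and n :: nat and X :: "nat \<Rightarrow> 'a \<Rightarrow> 'b"
  assumes "information_space M b"
    and "n \<ge> 2"
    and "\<And>i. i \<in> {1..n} \<Longrightarrow> simple_function M (X i)"
  shows "information_space.O_information M b n X =
    information_space.RSI M b (n - 1) X (X n)
    + (\<Sum>j = 2..n - 2. information_space.conditional_RSI M b j X (X (j + 1))
                          (subvector X {j + 2..n}))"
proof -
  interpret information_space M b by fact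
  let ?r = "rsi_term (\<lambda>J. \<H>(subvector X J)) n"
  have "O_information n X = (\<Sum>j = 1..n-1. ?r j)"
    using assms(2,3)
    by (subst sum_rsi_term)
      (simp_all add: O_information_def entropy_subvector_empty entropy_subvector_singleton)
  also have "\<dots> = ?r (n - 1) + (\<Sum>j = 1..n-2. ?r j)"
  proof -
    have "{1..n-1} = insert (n-1) {1..n-2}" using assms(2) by auto
    moreover have "n - 1 \<notin> {1..n-2}" using assms(2) by auto
    ultimately show ?thesis by simp
  qed
  also have "(\<Sum>j = 1..n-2. ?r j) = (\<Sum>j = 2..n-2. ?r j)"
    using rsi_term_1[OF assms(2)] by (intro sum.mono_neutral_right) (auto simp: not_le less_Suc_eq numeral_2_eq_2)
  also have "\<dots> = (\<Sum>j = 2..n-2. conditional_RSI j X (X (j + 1)) (subvector X {j + 2..n}))"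
    using assms(2,3) by (intro sum.cong conditional_RSI_eq_rsi_term[symmetric]) auto
  also have "?r (n - 1) = RSI (n - 1) X (X n)"
    using assms(2,3) by (intro RSI_eq_rsi_term[symmetric]) auto
  finally show ?thesis .
qed

end
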